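(* For integers $0\le k\le m\le n$, there is a bijection between the set of free Dyck paths of length $2n$ with $m$ flaws in $k$ flaw blocks and the set of doubly rooted plane trees with $n$ edges, stem size $k$ and $m$ prefix edges.
   Context: A free Dyck path of length $2n$ is a lattice path from $(0,0)$ to $(2n,0)$ with $n$ up steps $(1,1)$ and $n$ down steps $(1,-1)$. It has $m$ flaws if exactly $m$ of its up steps lie below the $x$-axis (go from height $-j$ to $-j+1$ with $j\ge1$). A flaw block is a maximal segment of the path that starts and ends on the $x$-axis and is otherwise strictly below it (a negative elevated Dyck path); the number of flaw blocks equals the number of down steps going from height $0$ to height $-1$. A doubly rooted plane tree is a plane tree (rooted, children linearly ordered) with a distinguished vertex $w$. Its stem is the path from the root to $w$; the stem size is the number of edges of the stem. Label the vertices $0,1,\dots,n$ in right-to-left preorder (visit the root, then recursively the subtrees of the root from rightmost to leftmost); an edge is a prefix edge if it lies on the stem or to the right of the stem, equivalently if its lower endpoint has label at most the label of $w$. *)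

theory Defs
  imports Main "HOL-Library.Sublist"
begin

text \<open>
  A lattice path starting at the origin is given by its list of steps; after \<open>i\<close> steps it is at
  the point \<open>(i, height p i)\<close>.
\<close>

datatype step = Up | Down

fun rise :: "step \<Rightarrow> int" where
  "rise Up = 1"
| "rise Down = -1"

definition height :: "step list \<Rightarrow> nat \<Rightarrow> int" where
  "height p i = (\<Sum>s\<leftarrow>take i p. rise s)"

definition free_dyck_path :: "nat \<Rightarrow> step list \<Rightarrow> bool" where
  "free_dyck_path n p \<longleftrightarrow> length p = 2 * n \<and> count_list p Up = n \<and> count_list p Down = n"

definition flaws :: "step list \<Rightarrow> nat" where
  "flaws p = card {i. i < length p \<and> p ! i = Up \<and> height p i < 0}"

text \<open>
  The segment of the path between the abscissae \<open>i < j\<close>. Its interior is nonempty, since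
  consecutive heights differ by one.
\<close>

definition negative_elevated :: "step list \<Rightarrow> nat \<Rightarrow> nat \<Rightarrow> bool" where
  "negative_elevated p i j \<longleftrightarrow>
     i < j \<and> j \<le> length p \<and> height p i = 0 \<and> height p j = 0 \<and>
     (\<forall>l. i < l \<and> l < j \<longrightarrow> height p l < 0)"

definition flaw_block :: "step list \<Rightarrow> nat \<Rightarrow> nat \<Rightarrow> bool" where
  "flaw_block p i j \<longleftrightarrow> negative_elevated p i j \<and>
     (\<forall>i' j'. negative_elevated p i' j' \<and> i' \<le> i \<and> j \<le> j' \<longrightarrow> i' = i \<and> j' = j)"

definition num_flaw_blocks :: "step list \<Rightarrow> nat" where
  "num_flaw_blocks p = card {(i, j). flaw_block p i j}"

definition dyck_paths_with_flaws :: "nat \<Rightarrow> nat \<Rightarrow> nat \<Rightarrow> step list set" where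
  "dyck_paths_with_flaws n m k =
     {p. free_dyck_path n p \<and> flaws p = m \<and> num_flaw_blocks p = k}"

text \<open>
  The list of subtrees of the root is ordered from left to right. A vertex is addressed by the
  list of child indices leading to it from the root, which is \<open>[]\<close>.
\<close>

datatype plane_tree = Node "plane_tree list"

fun is_vertex :: "plane_tree \<Rightarrow> nat list \<Rightarrow> bool" where
  "is_vertex t [] \<longleftrightarrow> True"
| "is_vertex (Node ts) (i # v) \<longleftrightarrow> i < length ts \<and> is_vertex (ts ! i) v"

definition vertices :: "plane_tree \<Rightarrow> nat list set" where
  "vertices t = {v. is_vertex t v}"

text \<open>An edge is the pair of its upper and its lower endpoint.\<close>

definition edges :: "plane_tree \<Rightarrow> (nat list \<times> nat list) set" where
  "edges t = {(u, v). u \<in> vertices t \<and> v \<in> vertices t \<and> (\<exists>i. v = u @ [i])}"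

definition stem :: "plane_tree \<Rightarrow> nat list \<Rightarrow> (nat list \<times> nat list) set" where
  "stem t w = {(u, v) \<in> edges t. prefix v w}"

function rl_preorder :: "plane_tree \<Rightarrow> nat list list" where
  "rl_preorder (Node ts) =
     [] # concat (rev (map (\<lambda>i. map ((#) i) (rl_preorder (ts ! i))) [0..<length ts]))"
  by pat_completeness auto
termination
  by (relation "measure size") (auto simp: less_Suc_eq_le intro!: size_list_estimation' [OF nth_mem])

text \<open>The label of a vertex is its position in the traversal.\<close>

definition label :: "plane_tree \<Rightarrow> nat list \<Rightarrow> nat" where
  "label t v = length (takeWhile (\<lambda>u. u \<noteq> v) (rl_preorder t))"

definition prefix_edges :: "plane_tree \<Rightarrow> nat list \<Rightarrow> (nat list \<times> nat list) set" where
  "prefix_edges t w = {(u, v) \<in> edges t. label t v \<le> label t w}"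

lemma set_rl_preorder: "set (rl_preorder t) = vertices t"
proof (induction t rule: rl_preorder.induct)
  case (1 ts)
  show ?case
  proof (rule set_eqI)
    fix v
    show "v \<in> set (rl_preorder (Node ts)) \<longleftrightarrow> v \<in> vertices (Node ts)"
    proof (cases v)
      case Nil
      then show ?thesis by (simp add: vertices_def)
    next
      case (Cons i v')
      then show ?thesis using 1 by (auto simp: vertices_def)
    qed
  qed
qed

text \<open>
  As the facts below show, an edge is a prefix edge iff it is on the stem or its branch leaves the
  stem strictly above \<open>w\<close> and to the right of the next stem edge.
\<close>

definition right_of :: "nat list \<Rightarrow> nat list \<Rightarrow> bool" where
  "right_of v w \<longleftrightarrow> (\<exists>a i j v' w'. v = a @ i # v' \<and> w = a @ j # w' \<and> j < i)"

lemma right_of_simps [simp]: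
  "\<not> right_of [] w" "\<not> right_of v []"
  "right_of (i # v) (j # w) \<longleftrightarrow> j < i \<or> i = j \<and> right_of v w"
proof -
  show "right_of (i # v) (j # w) \<longleftrightarrow> j < i \<or> i = j \<and> right_of v w"
  proof
    assume "right_of (i # v) (j # w)"
    then obtain a i' j' v' w' where *: "i # v = a @ i' # v'" "j # w = a @ j' # w'" "j' < i'"
      by (auto simp: right_of_def)
    then show "j < i \<or> i = j \<and> right_of v w"
      by (cases a) (auto simp: right_of_def)
  next
    assume "j < i \<or> i = j \<and> right_of v w"
    then show "right_of (i # v) (j # w)"
    proof
      assume "j < i"
      then show ?thesis unfolding right_of_def by (intro exI[of _ "[]"]) auto
    next
      assume "i = j \<and> right_of v w"
      then show ?thesis unfolding right_of_def by (metis append_Cons)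
    qed
  qed
qed (auto simp: right_of_def)

definition before :: "nat list \<Rightarrow> nat list \<Rightarrow> bool" where
  "before v w \<longleftrightarrow> strict_prefix v w \<or> right_of v w"

lemma before_simps [simp]:
  "before [] (j # w)" "\<not> before v []"
  "before (i # v) (j # w) \<longleftrightarrow> j < i \<or> i = j \<and> before v w"
  by (auto simp: before_def)

lemma before_antisym: "before v w \<Longrightarrow> \<not> before w v"
proof (induction v arbitrary: w)
  case Nil
  then show ?case by simp
next
  case (Cons i v)
  then show ?case by (cases w) auto
qed

lemma sorted_concat_rev:
  assumes "\<And>i. i < n \<Longrightarrow> sorted_wrt before (f i)"
  shows "sorted_wrt before (concat (rev (map (\<lambda>i. map ((#) i) (f i)) [0..<n])))"
  using assms
proof (induction n)
  case 0
  then show ?case by simp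
next
  case (Suc n)
  then show ?case by (auto simp: sorted_wrt_append sorted_wrt_map)
qed

lemma sorted_rl_preorder: "sorted_wrt before (rl_preorder t)"
proof (induction t rule: rl_preorder.induct)
  case (1 ts)
  then have "sorted_wrt before
      (concat (rev (map (\<lambda>i. map ((#) i) (rl_preorder (ts ! i))) [0..<length ts])))"
    by (intro sorted_concat_rev) auto
  then show ?case by auto
qed

lemma nth_label:
  assumes "v \<in> vertices t"
  shows "label t v < length (rl_preorder t)" "rl_preorder t ! label t v = v"
proof -
  show *: "label t v < length (rl_preorder t)"
    using assms unfolding label_def set_rl_preorder [symmetric]
    by (metis (mono_tags, lifting) length_takeWhile_le nat_less_le takeWhile_eq_all_conv
        takeWhile_eq_take take_all_iff order_refl)
  show "rl_preorder t ! label t v = v"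
    using nth_length_takeWhile [of "\<lambda>u. u \<noteq> v" "rl_preorder t"] * unfolding label_def by auto
qed

lemma distinct_rl_preorder: "distinct (rl_preorder t)"
  using sorted_rl_preorder [of t] before_antisym
  unfolding distinct_conv_nth sorted_wrt_iff_nth_less by (metis linorder_neqE_nat)

lemma label_le_iff:
  assumes "v \<in> vertices t" "w \<in> vertices t"
  shows "label t v \<le> label t w \<longleftrightarrow> prefix v w \<or> right_of v w"
proof -
  have *: "before x y" if "label t x < label t y" "x \<in> vertices t" "y \<in> vertices t" for x y
    using sorted_wrt_nth_less [OF sorted_rl_preorder that(1) nth_label(1) [OF that(3)]]
    by (simp add: nth_label that)
  consider "label t v < label t w" | "v = w" | "label t w < label t v"
    using nth_label(2) [OF assms(1)] nth_label(2) [OF assms(2)] by (metis linorder_neqE_nat)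
  then show ?thesis
  proof cases
    case 1
    then show ?thesis using * [OF 1 assms] by (auto simp: before_def)
  next
    case 2
    then show ?thesis by simp
  next
    case 3
    then have "\<not> before v w" "v \<noteq> w" using * [OF 3 assms(2,1)] before_antisym by auto
    then show ?thesis using 3 by (auto simp: before_def strict_prefix_def)
  qed
qed

lemma prefix_edges_iff:
  assumes "w \<in> vertices t"
  shows "prefix_edges t w = stem t w \<union> {(u, v) \<in> edges t. right_of v w}"
  using label_le_iff [OF _ assms] by (auto simp: prefix_edges_def stem_def edges_def)

definition doubly_rooted_trees :: "nat \<Rightarrow> nat \<Rightarrow> nat \<Rightarrow> (plane_tree \<times> nat list) set" where
  "doubly_rooted_trees n k m =
     {(t, w). w \<in> vertices t \<and> card (edges t) = n \<and>
              card (stem t w) = k \<and> card (prefix_edges t w) = m}"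

end

theory Submission
  imports Defs
begin

text \<open>
  Both sides carry the same data: \<open>k\<close> pairs of plane forests and one further plane forest.
  A path with \<open>k\<close> flaw blocks is \<open>D\<^sub>1 N\<^sub>1 \<dots> D\<^sub>k N\<^sub>k D\<close> with Dyck paths \<open>D\<^sub>i\<close>, \<open>D\<close> and negative
  elevated paths \<open>N\<^sub>i\<close>, and Dyck paths encode plane forests. In a tree with stem size \<open>k\<close>, the
  \<open>D\<^sub>i\<close> and the \<open>N\<^sub>i\<close> (with the outer steps removed) become the forests to the left and to the right
  of the stem at its \<open>i\<close>-th vertex, the outer steps of \<open>N\<^sub>i\<close> become the \<open>i\<close>-th stem edge, and
  \<open>D\<close> becomes the forest below \<open>w\<close>.
\<close>

section \<open>Codes: the data shared by paths and trees\<close>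

type_synonym forest = "plane_tree list"

type_synonym code = "(forest \<times> forest) list \<times> forest"

fun forest_edges :: "forest \<Rightarrow> nat" where
  "forest_edges [] = 0"
| "forest_edges (Node ts # us) = Suc (forest_edges ts + forest_edges us)"

text \<open>The summand of a pair counts the edges of \<open>r\<close> and one more: the closing up
  step of the negative block on the path side, the stem edge on the tree side.\<close>

definition code_flaws :: "code \<Rightarrow> nat" where
  "code_flaws c = (\<Sum>(l, r)\<leftarrow>fst c. Suc (forest_edges r))"

text \<open>\<open>code_flaws\<close> already covers the right forests and the stem edges, which
  leaves the left forests and the forest below the marked vertex.\<close>

definition code_edges :: "code \<Rightarrow> nat" where
  "code_edges c = code_flaws c + (\<Sum>(l, r)\<leftarrow>fst c. forest_edges l) + forest_edges (snd c)"


section \<open>Paths\<close>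

text \<open>The first-return decomposition: the outer \<open>Up\<close> and its matching
  \<open>Down\<close> stand for the edge above the first tree.\<close>

fun dyck :: "forest \<Rightarrow> step list" where
  "dyck [] = []"
| "dyck (Node ts # us) = Up # dyck ts @ Down # dyck us"

fun flip :: "step \<Rightarrow> step" where
  "flip Up = Down"
| "flip Down = Up"

definition neg_dyck :: "forest \<Rightarrow> step list" where
  "neg_dyck ts = map flip (dyck ts)"

fun path_of_aux :: "(forest \<times> forest) list \<Rightarrow> forest \<Rightarrow> step list" where
  "path_of_aux [] d = dyck d"
| "path_of_aux ((l, r) # ps) d = dyck l @ (Down # neg_dyck r @ [Up]) @ path_of_aux ps d"

definition path_of :: "code \<Rightarrow> step list" where
  "path_of c = path_of_aux (fst c) (snd c)"

lemma flip_flip [simp]: "flip (flip s) = s"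
  by (cases s) auto

lemma flip_comp_flip [simp]: "flip \<circ> flip = id"
  by auto

lemma inj_flip: "inj flip"
  by (metis flip_flip injI)

lemma count_flip [simp]:
  "count_list (map flip p) Up = count_list p Down"
  "count_list (map flip p) Down = count_list p Up"
proof (induction p)
  case (Cons s p)
  case 1 show ?case using Cons by (cases s) auto
  case 2 show ?case using Cons by (cases s) auto
qed auto

lemma rise_flip [simp]: "rise (flip s) = - rise s"
  by (cases s) auto

lemma count_dyck [simp]:
  "count_list (dyck ts) Up = forest_edges ts" "count_list (dyck ts) Down = forest_edges ts"
  by (induction ts rule: dyck.induct) auto

lemma count_neg_dyck [simp]:
  "count_list (neg_dyck ts) Up = forest_edges ts" "count_list (neg_dyck ts) Down = forest_edges ts"
  by (simp_all add: neg_dyck_def)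

lemma length_eq_count: "length p = count_list p Up + count_list p Down"
proof (induction p)
  case (Cons s p)
  then show ?case by (cases s) auto
qed simp

lemma length_dyck [simp]: "length (dyck ts) = 2 * forest_edges ts"
  by (simp add: length_eq_count)

lemma length_neg_dyck [simp]: "length (neg_dyck ts) = 2 * forest_edges ts"
  by (simp add: neg_dyck_def)

section \<open>Unique readability of the path encoding\<close>

text \<open>\<open>dyck ts\<close> never drops below its starting height, so the \<open>Down\<close>
  after it is the first step that does and marks its end. The arbitrary tails \<open>p\<close> and
  \<open>q\<close> let the induction hypothesis apply to the first tree, whose own closing
  \<open>Down\<close> is followed by the rest.\<close>

lemma dyck_append_Down_inject:
  "dyck ts @ Down # p = dyck us @ Down # q \<longleftrightarrow> ts = us \<and> p = q"
proof (induction ts arbitrary: us p q rule: dyck.induct)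
  case 1
  show ?case by (cases us rule: dyck.cases) auto
next
  case (2 ts1 ts2)
  show ?case
  proof (cases us rule: dyck.cases)
    case (2 us1 us2)
    then show ?thesis using "2.IH" by auto
  qed auto
qed

lemma dyck_inject: "dyck ts = dyck us \<longleftrightarrow> ts = us"
  using dyck_append_Down_inject [of ts "[]" us "[]"] by auto

lemma dyck_neq_append_Down: "dyck ts \<noteq> dyck us @ Down # q"
  \<comment> \<open>Appending a \<open>Down\<close> to both sides would force
    \<open>[] = q @ [Down]\<close>.\<close>
  using dyck_append_Down_inject [of ts "[]" us "q @ [Down]"] by auto

lemma neg_dyck_append_Up_inject:
  "neg_dyck ts @ Up # p = neg_dyck us @ Up # q \<longleftrightarrow> ts = us \<and> p = q" (is "?l = ?r \<longleftrightarrow> _")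
proof -
  have "?l = ?r \<longleftrightarrow> map flip ?l = map flip ?r"
    by (metis inj_flip inj_map_eq_map)
  also have "\<dots> \<longleftrightarrow> ts = us \<and> map flip p = map flip q"
    by (simp add: neg_dyck_def dyck_append_Down_inject)
  finally show ?thesis
    by (metis inj_flip inj_map_eq_map)
qed

text \<open>The code is read off from left to right: the first step below the axis ends
  \<open>l\<close>, the first return to the axis ends \<open>r\<close>, and when no step goes below
  the axis only \<open>d\<close> remains.\<close>

lemma path_of_aux_inject:
  "path_of_aux ps d = path_of_aux qs e \<Longrightarrow> ps = qs \<and> d = e"
proof (induction ps d arbitrary: qs rule: path_of_aux.induct)
  case (1 d)
  then show ?case
    by (cases "(qs, e)" rule: path_of_aux.cases) (auto simp: dyck_inject dyck_neq_append_Down)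
next
  case (2 l r ps d)
  then show ?case
    by (cases "(qs, e)" rule: path_of_aux.cases)
      (auto simp: dyck_append_Down_inject neg_dyck_append_Up_inject
        dyck_neq_append_Down [symmetric])
qed

lemma inj_path_of: "inj path_of"
  by (rule injI) (auto simp: path_of_def prod_eq_iff dest: path_of_aux_inject)

section \<open>Every balanced path has a code\<close>

text \<open>The path ends no higher than it starts. Either it never goes below its start and is a
  Dyck path, or its first step below the start follows a Dyck path.\<close>

lemma dyck_decomposition:
  assumes "count_list p Up \<le> count_list p Down"
  shows "(\<exists>ts. p = dyck ts) \<or> (\<exists>ts q. p = dyck ts @ Down # q)"
  using assms
proof (induction "length p" arbitrary: p rule: less_induct)
  case less
  show ?case
  proof (cases p)
    case Nil
    then show ?thesis by (metis dyck.simps(1))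
  next
    case (Cons s p')
    show ?thesis
    proof (cases s)
      case Down
      then show ?thesis using Cons by (metis append_Nil dyck.simps(1))
    next
      case Up
      then have p: "p = Up # p'" and lt: "count_list p' Up < count_list p' Down"
        using Cons less.prems by auto
      \<comment> \<open>A Dyck path is balanced, whereas \<open>p'\<close> has lost an
        \<open>Up\<close>; hence only the second alternative is possible for \<open>p'\<close>, and
        its \<open>Down\<close> matches the leading \<open>Up\<close> of \<open>p\<close>.\<close>
      have "\<nexists>ts. p' = dyck ts"
        using lt by auto
      then obtain ts q where q: "p' = dyck ts @ Down # q"
        using less.hyps [of p'] p lt by auto
      have "count_list q Up \<le> count_list q Down" "length q < length p"
        using lt p q by auto
      then consider us where "q = dyck us" | us q' where "q = dyck us @ Down # q'"
        using less.hyps by blast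
      then show ?thesis
      proof cases
        case (1 us)
        then have "p = dyck (Node ts # us)" using p q by simp
        then show ?thesis by blast
      next
        case (2 us q')
        then have "p = dyck (Node ts # us) @ Down # q'" using p q by simp
        then show ?thesis by blast
      qed
    qed
  qed
qed

text \<open>Split off the Dyck path before the first step below the axis, reflect what follows to
  find the first return in the same way, and recurse on the balanced remainder.\<close>

lemma path_of_aux_surj:
  assumes "count_list p Up = count_list p Down"
  shows "\<exists>ps d. p = path_of_aux ps d"
  using assms
proof (induction "length p" arbitrary: p rule: less_induct)
  case less
  consider d where "p = dyck d" | l q where "p = dyck l @ Down # q"
    using dyck_decomposition [of p] less.prems by auto
  then show ?case
  proof cases
    case (1 d)
    then show ?thesis by (metis path_of_aux.simps(1))
  next
    case (2 l q)
    then have count: "count_list q Up = Suc (count_list q Down)"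
      using less.prems by simp
    \<comment> \<open>Beyond its first \<open>Down\<close> the path has one \<open>Up\<close> too
      many, so the reflected rest is not balanced and must pass below its start.\<close>
    have "\<nexists>ts. map flip q = dyck ts"
      using count by (metis count_dyck count_flip n_not_Suc_n)
    then obtain r q' where "map flip q = dyck r @ Down # q'"
      using dyck_decomposition [of "map flip q"] count by auto
    then have "map flip (map flip q) = map flip (dyck r @ Down # q')"
      by simp
    then have q: "q = neg_dyck r @ Up # map flip q'"
      by (simp add: neg_dyck_def)
    obtain ps d where "map flip q' = path_of_aux ps d"
      using less.hyps [of "map flip q'"] count by (auto simp: 2 q)
    then have "p = path_of_aux ((l, r) # ps) d"
      by (simp add: 2 q)
    then show ?thesis by blast
  qed
qed

lemma count_path_of_aux:
  "count_list (path_of_aux ps d) Up = code_edges (ps, d)"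
  "count_list (path_of_aux ps d) Down = code_edges (ps, d)"
  by (induction ps d rule: path_of_aux.induct) (auto simp: code_edges_def code_flaws_def)

lemma free_dyck_path_path_of: "free_dyck_path n (path_of c) \<longleftrightarrow> code_edges c = n"
  by (auto simp: free_dyck_path_def path_of_def count_path_of_aux length_eq_count)

lemma free_dyck_path_imp_path_of:
  assumes "free_dyck_path n p"
  shows "p \<in> range path_of"
proof -
  obtain ps d where "p = path_of (ps, d)"
    using path_of_aux_surj [of p] assms by (auto simp: free_dyck_path_def path_of_def)
  then show ?thesis by blast
qed

section \<open>Heights of Dyck paths and negative blocks\<close>

lemma height_0 [simp]: "height p 0 = 0"
  by (simp add: height_def)

lemma height_Cons_Suc [simp]: "height (s # p) (Suc i) = rise s + height p i"
  by (simp add: height_def)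

lemma height_Suc: "i < length p \<Longrightarrow> height p (Suc i) = height p i + rise (p ! i)"
  by (simp add: height_def take_Suc_conv_app_nth)

lemma height_append:
  "height (p @ q) i = (if i \<le> length p then height p i
                       else height p (length p) + height q (i - length p))"
  by (simp add: height_def)

lemma height_length: "height p (length p) = int (count_list p Up) - int (count_list p Down)"
proof (induction p)
  case (Cons s p)
  then show ?case by (cases s) auto
qed simp

lemma height_flip: "height (map flip p) i = - height p i"
  by (simp add: height_def take_map o_def uminus_sum_list_map)

lemma height_dyck_nonneg: "0 \<le> height (dyck ts) i"
proof (induction ts arbitrary: i rule: dyck.induct)
  case (2 ts us)
  show ?case
  proof (cases i)
    case (Suc j)
    show ?thesis
    proof (cases "j \<le> length (dyck ts)")
      case True
      then show ?thesis using 2(1) [of j] Suc by (simp add: height_append)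
    next
      case False
      \<comment> \<open>Index \<open>j\<close> lies beyond the matching \<open>Down\<close>: the
        outer two steps cancel, and the height is that of \<open>dyck us\<close> at
        \<open>l\<close>.\<close>
      then obtain l where "j - length (dyck ts) = Suc l"
        by (metis Suc_diff_Suc not_le)
      then show ?thesis using 2(2) [of l] Suc False height_length [of "dyck ts"]
        by (simp add: height_append)
    qed
  qed simp
qed (simp add: height_def)

lemma height_neg_dyck_nonpos: "height (neg_dyck ts) i \<le> 0"
  using height_dyck_nonneg by (simp add: neg_dyck_def height_flip)

abbreviation neg_block :: "forest \<Rightarrow> step list" where
  "neg_block r \<equiv> Down # neg_dyck r @ [Up]"

text \<open>The leading \<open>Down\<close> lowers the nonpositive heights of
  \<open>neg_dyck r\<close> by one.\<close>

lemma height_neg_block: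
  assumes "0 < i" "i < length (neg_block r)"
  shows "height (neg_block r) i < 0"
proof -
  obtain j where "i = Suc j" "j \<le> length (neg_dyck r)"
    using assms by (cases i) auto
  then show ?thesis
    using height_neg_dyck_nonpos [of r j] by (simp add: height_append)
qed

section \<open>Counting flaws and flaw blocks\<close>

text \<open>Since \<open>p\<close> ends on the axis, the steps of \<open>q\<close> keep their
  heights; only their positions move by \<open>length p\<close>.\<close>

lemma flaws_append:
  assumes "height p (length p) = 0"
  shows "flaws (p @ q) = flaws p + flaws q"
proof -
  let ?F = "\<lambda>p. {i. i < length p \<and> p ! i = Up \<and> height p i < 0}"
  have "?F (p @ q) = ?F p \<union> (+) (length p) ` ?F q" (is "?A = ?B")
  proof (rule set_eqI)
    fix i
    show "i \<in> ?A \<longleftrightarrow> i \<in> ?B"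
    proof (cases "i < length p")
      case True
      then show ?thesis by (auto simp: nth_append height_append)
    next
      case False
      then obtain j where "i = length p + j" by (metis le_add_diff_inverse not_less)
      then show ?thesis using assms by (auto simp: nth_append height_append)
    qed
  qed
  moreover have "?F p \<inter> (+) (length p) ` ?F q = {}" by auto
  ultimately show ?thesis
    by (simp add: flaws_def card_Un_disjoint card_image)
qed

lemma flaws_dyck: "flaws (dyck ts) = 0"
  using height_dyck_nonneg [of ts] by (simp add: flaws_def leD)

lemma card_nth_eq_count: "card {i. i < length p \<and> p ! i = s} = count_list p s"
  by (simp add: count_list_eq_length_filter length_filter_conv_card eq_commute)

text \<open>Every up step of the block starts below the axis, so flaws are just up steps: those of
  \<open>neg_dyck r\<close> and the final one.\<close>

lemma flaws_neg_block: "flaws (neg_block r) = Suc (forest_edges r)"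
proof -
  have "{i. i < length (neg_block r) \<and> neg_block r ! i = Up \<and> height (neg_block r) i < 0}
      = {i. i < length (neg_block r) \<and> neg_block r ! i = Up}"
    (is "?A = ?B")
  proof (intro equalityI subsetI)
    fix i
    assume i: "i \<in> ?B"
    \<comment> \<open>The step at position \<open>0\<close>, the only one starting on the axis, is a
      \<open>Down\<close>.\<close>
    then have "0 < i" by (cases i) auto
    then show "i \<in> ?A" using i height_neg_block [of i r] by blast
  qed blast
  then show ?thesis
    unfolding flaws_def by (simp only: card_nth_eq_count) simp
qed

lemma flaws_path_of: "flaws (path_of c) = code_flaws c"
proof -
  have "flaws (path_of_aux ps d) = code_flaws (ps, d)" for ps d
  proof (induction ps d rule: path_of_aux.induct)
    case (1 d)
    then show ?case by (simp add: code_flaws_def flaws_dyck)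
  next
    case (2 l r ps d)
    have "height (dyck l) (length (dyck l)) = 0"
      "height (neg_block r) (length (neg_block r)) = 0"
      by (simp_all only: height_length) simp_all
    then show ?case using 2
      unfolding path_of_aux.simps
      by (simp only: flaws_append flaws_dyck flaws_neg_block) (simp add: code_flaws_def)
  qed
  then show ?thesis by (simp add: path_of_def)
qed

text \<open>Endpoints have height \<open>0\<close>, so no negative elevated segment lies properly inside another.\<close>

lemma flaw_block_iff: "flaw_block p i j \<longleftrightarrow> negative_elevated p i j"
proof -
  have "i' = i \<and> j' = j"
    if "negative_elevated p i j" "negative_elevated p i' j'" "i' \<le> i" "j \<le> j'" for i' j'
  proof -
    have "height p i = 0" "height p j = 0" "i < j" using that by (auto simp: negative_elevated_def)
    then have "\<not> (i' < i \<and> i < j')" "\<not> (i' < j \<and> j < j')"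
      using that(2) by (fastforce simp: negative_elevated_def)+
    then show ?thesis using \<open>i < j\<close> that(3,4) by auto
  qed
  then show ?thesis by (auto simp: flaw_block_def)
qed

definition neg_segments :: "step list \<Rightarrow> (nat \<times> nat) set" where
  "neg_segments p = {(i, j). negative_elevated p i j}"

lemma num_flaw_blocks_eq: "num_flaw_blocks p = card (neg_segments p)"
  by (simp add: num_flaw_blocks_def neg_segments_def flaw_block_iff)

lemma finite_neg_segments: "finite (neg_segments p)"
  by (rule finite_subset [of _ "{..length p} \<times> {..length p}"])
    (auto simp: neg_segments_def negative_elevated_def)

text \<open>A segment cannot straddle the junction, where the height is \<open>0\<close>, because
  its interior is strictly negative. It therefore lies in \<open>p\<close> or is a translate of a
  segment of \<open>q\<close>.\<close>

lemma neg_segments_append: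
  assumes "height p (length p) = 0"
  shows "neg_segments (p @ q) =
    neg_segments p \<union> map_prod ((+) (length p)) ((+) (length p)) ` neg_segments q"
    (is "_ = _ \<union> ?f ` _")
proof (rule set_eqI, rule prod.induct)
  let ?n = "length p"
  fix i j
  have left: "negative_elevated (p @ q) i j \<longleftrightarrow> negative_elevated p i j" if "j \<le> ?n"
    using that by (auto simp: negative_elevated_def height_append)
  have right: "negative_elevated (p @ q) (?n + a) (?n + b) \<longleftrightarrow> negative_elevated q a b" for a b
  proof -
    have h: "height (p @ q) (?n + x) = height q x" for x
      using assms by (auto simp: height_append)
    have "(\<forall>l. ?n + a < l \<and> l < ?n + b \<longrightarrow> height (p @ q) l < 0) \<longleftrightarrow>
        (\<forall>l. a < l \<and> l < b \<longrightarrow> height q l < 0)"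
      (is "?L \<longleftrightarrow> ?R")
    proof
      assume ?L
      then show ?R by (metis h add_less_cancel_left)
    next
      assume R: ?R
      show ?L
      proof (intro allI impI)
        fix l
        assume "?n + a < l \<and> l < ?n + b"
        then have "a < l - ?n" "l - ?n < b" "l = ?n + (l - ?n)" by auto
        then show "height (p @ q) l < 0" using R h by metis
      qed
    qed
    then show ?thesis by (simp add: negative_elevated_def h)
  qed
  show "(i, j) \<in> neg_segments (p @ q) \<longleftrightarrow> (i, j) \<in> neg_segments p \<union> ?f ` neg_segments q"
  proof (cases "j \<le> ?n")
    case True
    then show ?thesis using left
      by (auto simp: neg_segments_def negative_elevated_def)
  next
    case j: False
    then have 1: "(i, j) \<notin> neg_segments p"
      by (auto simp: neg_segments_def negative_elevated_def)
    show ?thesis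
    proof (cases "i < ?n")
      case True
      have "height (p @ q) ?n = 0" using assms by (simp add: height_append)
      then show ?thesis using True j 1 by (auto simp: neg_segments_def negative_elevated_def)
    next
      case False
      then obtain a b where "i = ?n + a" "j = ?n + b"
        using j by (metis le_add_diff_inverse not_less nat_le_linear)
      then show ?thesis using 1 right by (auto simp: neg_segments_def)
    qed
  qed
qed

lemma num_flaw_blocks_append:
  assumes "height p (length p) = 0"
  shows "num_flaw_blocks (p @ q) = num_flaw_blocks p + num_flaw_blocks q"
proof -
  let ?f = "map_prod ((+) (length p)) ((+) (length p))"
  have "neg_segments p \<inter> ?f ` neg_segments q = {}"
    by (auto simp: neg_segments_def negative_elevated_def)
  moreover have "inj_on ?f (neg_segments q)"
    by (auto simp: inj_on_def)
  ultimately show ?thesis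
    by (simp add: num_flaw_blocks_eq neg_segments_append [OF assms] card_Un_disjoint
        finite_neg_segments card_image)
qed

text \<open>A segment has at least two steps, so the point after its first step is interior and
  would have negative height.\<close>

lemma num_flaw_blocks_dyck: "num_flaw_blocks (dyck ts) = 0"
proof -
  have False if "negative_elevated (dyck ts) i j" for i j
  proof -
    have "height (dyck ts) (Suc i) \<noteq> 0"
      using that height_Suc [of i "dyck ts"]
      by (cases "dyck ts ! i") (auto simp: negative_elevated_def)
    then have "Suc i < j"
      using that by (metis Suc_lessI negative_elevated_def)
    then have "height (dyck ts) (Suc i) < 0"
      using that by (simp add: negative_elevated_def)
    then show False using height_dyck_nonneg [of ts "Suc i"] by simp
  qed
  then have "neg_segments (dyck ts) = {}" by (auto simp: neg_segments_def)
  then show ?thesis by (simp add: num_flaw_blocks_eq)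
qed

text \<open>The block meets the axis only at its two ends, so the whole block is the only
  segment.\<close>

lemma num_flaw_blocks_neg_block: "num_flaw_blocks (neg_block r) = 1"
proof -
  let ?p = "neg_block r"
  have "height ?p (length ?p) = 0"
    by (simp only: height_length) simp
  then have "negative_elevated ?p 0 (length ?p)"
    using height_neg_block [of _ r] unfolding negative_elevated_def by simp
  moreover have "i = 0 \<and> j = length ?p" if "negative_elevated ?p i j" for i j
  proof -
    have "height ?p i = 0" "height ?p j = 0" "i < j" "j \<le> length ?p"
      using that unfolding negative_elevated_def by blast+
    then have "\<not> 0 < i" "\<not> j < length ?p"
      using height_neg_block [of i r] height_neg_block [of j r] by linarith+
    with \<open>j \<le> length ?p\<close> show ?thesis by linarith
  qed
  ultimately have "negative_elevated ?p i j \<longleftrightarrow> i = 0 \<and> j = length ?p" for i j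
    by blast
  then have "neg_segments ?p = {(0, length ?p)}"
    by (simp add: neg_segments_def set_eq_iff)
  then show ?thesis by (simp add: num_flaw_blocks_eq)
qed

lemma num_flaw_blocks_path_of: "num_flaw_blocks (path_of c) = length (fst c)"
proof -
  have "num_flaw_blocks (path_of_aux ps d) = length ps" for ps d
  proof (induction ps d rule: path_of_aux.induct)
    case (1 d)
    then show ?case by (simp add: num_flaw_blocks_dyck)
  next
    case (2 l r ps d)
    have "height (dyck l) (length (dyck l)) = 0"
      "height (neg_block r) (length (neg_block r)) = 0"
      by (simp_all only: height_length) simp_all
    then show ?case using 2
      unfolding path_of_aux.simps
      by (simp only: num_flaw_blocks_append num_flaw_blocks_dyck num_flaw_blocks_neg_block) simp
  qed
  then show ?thesis by (simp add: path_of_def)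
qed

lemma bij_betw_path_of:
  "bij_betw path_of {c. code_edges c = n \<and> code_flaws c = m \<and> length (fst c) = k}
     (dyck_paths_with_flaws n m k)"
proof (rule bij_betw_imageI)
  show "inj_on path_of {c. code_edges c = n \<and> code_flaws c = m \<and> length (fst c) = k}"
    using inj_path_of by (rule inj_on_subset) simp
  show "path_of ` {c. code_edges c = n \<and> code_flaws c = m \<and> length (fst c) = k}
      = dyck_paths_with_flaws n m k"
    using free_dyck_path_imp_path_of
    by (fastforce simp: dyck_paths_with_flaws_def free_dyck_path_path_of flaws_path_of
        num_flaw_blocks_path_of)
qed


section \<open>Trees\<close>

fun tree_of_aux :: "(forest \<times> forest) list \<Rightarrow> forest \<Rightarrow> plane_tree" where
  "tree_of_aux [] d = Node d"
| "tree_of_aux ((l, r) # ps) d = Node (l @ tree_of_aux ps d # r)"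

text \<open>The next stem vertex has \<open>length l\<close> siblings to its left, so these lengths
  form the address of the marked vertex.\<close>

definition tree_of :: "code \<Rightarrow> plane_tree \<times> nat list" where
  "tree_of c = (tree_of_aux (fst c) (snd c), map (\<lambda>(l, r). length l) (fst c))"

text \<open>The equal addresses fix where the child list \<open>l @ t # r\<close> is cut at each
  stem vertex; the tree alone would not determine this.\<close>

lemma tree_of_aux_inject:
  assumes "tree_of_aux ps d = tree_of_aux qs e"
    and "map (\<lambda>(l, r). length l) ps = map (\<lambda>(l, r). length l) qs"
  shows "ps = qs \<and> d = e"
  using assms
proof (induction ps d arbitrary: qs rule: tree_of_aux.induct)
  case (2 l r ps d)
  then show ?case by (cases qs) auto
qed auto

lemma inj_tree_of: "inj tree_of"
  by (rule injI) (auto simp: tree_of_def prod_eq_iff dest: tree_of_aux_inject)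

lemma vertex_tree_of_aux: "map (\<lambda>(l, r). length l) ps \<in> vertices (tree_of_aux ps d)"
  by (induction ps d rule: tree_of_aux.induct) (auto simp: vertices_def)

text \<open>Following \<open>w\<close> down from the root, cut each list of children at the index
  given by \<open>w\<close>; the children of the last vertex form \<open>d\<close>.\<close>

lemma tree_of_surj:
  assumes "is_vertex t w"
  shows "(t, w) \<in> range tree_of"
proof -
  have "\<exists>ps d. t = tree_of_aux ps d \<and> w = map (\<lambda>(l, r). length l) ps"
    using assms
  proof (induction t w rule: is_vertex.induct)
    case (1 t)
    then show ?case by (metis plane_tree.exhaust tree_of_aux.simps(1) list.simps(8))
  next
    case (2 ts i w)
    then obtain ps d where *: "ts ! i = tree_of_aux ps d" "w = map (\<lambda>(l, r). length l) ps"
      by auto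
    have "Node ts = tree_of_aux ((take i ts, drop (Suc i) ts) # ps) d"
      using id_take_nth_drop [of i ts] 2 * by simp
    moreover have "i # w = map (\<lambda>(l, r). length l) ((take i ts, drop (Suc i) ts) # ps)"
      using 2 * by simp
    ultimately show ?case by metis
  qed
  then obtain ps d where "(t, w) = tree_of (ps, d)"
    by (auto simp: tree_of_def)
  then show ?thesis by blast
qed

section \<open>Counting edges by their lower endpoints\<close>

definition forest_vertices :: "forest \<Rightarrow> nat list set" where
  "forest_vertices ts = vertices (Node ts) - {[]}"

lemma forest_vertices_Cons [simp]:
  "i # v \<in> forest_vertices ts \<longleftrightarrow> i < length ts \<and> v \<in> vertices (ts ! i)"
  by (simp add: forest_vertices_def vertices_def)

lemma Nil_notin_forest_vertices [simp]: "[] \<notin> forest_vertices ts"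
  by (simp add: forest_vertices_def)

lemma Nil_in_vertices [simp]: "[] \<in> vertices t"
  by (simp add: vertices_def)

lemma finite_vertices [simp]: "finite (vertices t)"
  by (metis List.finite_set set_rl_preorder)

lemma finite_forest_vertices [simp]: "finite (forest_vertices ts)"
  by (simp add: forest_vertices_def)

lemma card_vertices_Node: "card (vertices (Node ts)) = Suc (card (forest_vertices ts))"
  unfolding forest_vertices_def by (rule card.remove) auto

text \<open>Addresses in a forest after \<open>a\<close> trees are placed to its left. It is applied
  to forest vertices, which are nonempty lists, so \<open>hd\<close> is meaningful.\<close>

definition shift :: "nat \<Rightarrow> nat list \<Rightarrow> nat list" where
  "shift a v = (a + hd v) # tl v"

lemma shift_forest_vertices:
  "i # v \<in> shift a ` forest_vertices ts \<longleftrightarrow> a \<le> i \<and> i - a < length ts \<and> v \<in> vertices (ts ! (i - a))"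
proof
  assume "i # v \<in> shift a ` forest_vertices ts"
  then obtain x where "i # v = shift a x" "x \<in> forest_vertices ts" by blast
  then show "a \<le> i \<and> i - a < length ts \<and> v \<in> vertices (ts ! (i - a))"
    by (cases x) (auto simp: shift_def)
next
  assume "a \<le> i \<and> i - a < length ts \<and> v \<in> vertices (ts ! (i - a))"
  then have "i # v = shift a ((i - a) # v)" "(i - a) # v \<in> forest_vertices ts"
    by (auto simp: shift_def)
  then show "i # v \<in> shift a ` forest_vertices ts" by blast
qed

lemma card_shift_forest_vertices [simp]:
  "card (shift a ` forest_vertices ts) = card (forest_vertices ts)"
proof (rule card_image, rule inj_onI)
  fix x y
  assume "x \<in> forest_vertices ts" "y \<in> forest_vertices ts" "shift a x = shift a y"
  then show "x = y" by (cases x; cases y) (auto simp: shift_def)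
qed

lemma Nil_notin_shift [simp]: "[] \<notin> shift a ` A"
  by (auto simp: shift_def)

text \<open>The vertices of the first tree, whose root accounts for the \<open>Suc\<close>, get the
  leading index \<open>0\<close>; those of the remaining trees are shifted by one.\<close>

lemma card_forest_vertices: "card (forest_vertices ts) = forest_edges ts"
proof (induction ts rule: forest_edges.induct)
  case 1
  have "forest_vertices [] = {}"
    by (auto simp: forest_vertices_def vertices_def elim: is_vertex.elims)
  then show ?case by simp
next
  case (2 ts us)
  let ?A = "(#) 0 ` vertices (Node ts)" and ?B = "shift 1 ` forest_vertices us"
  have "v \<in> forest_vertices (Node ts # us) \<longleftrightarrow> v \<in> ?A \<union> ?B" for v
  proof (cases v)
    case (Cons i u)
    then show ?thesis by (cases i) (auto simp: shift_forest_vertices)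
  qed auto
  then have "forest_vertices (Node ts # us) = ?A \<union> ?B" by blast
  moreover have "?A \<inter> ?B = {}"
    by (auto simp: shift_def)
  ultimately show ?case
    using 2 by (simp add: card_Un_disjoint card_image card_vertices_Node)
qed

text \<open>An edge is determined by its lower endpoint, which is any vertex but the root.\<close>

lemma card_edges_such_that:
  "card {(u, v) \<in> edges t. P v} = card {v \<in> vertices t. v \<noteq> [] \<and> P v}"
proof -
  have vertex_prefix: "is_vertex t u" if "is_vertex t (u @ [i])" for t u i
    using that by (induction t u rule: is_vertex.induct) auto
  have "bij_betw snd {(u, v) \<in> edges t. P v} {v \<in> vertices t. v \<noteq> [] \<and> P v}"
  proof (rule bij_betw_imageI)
    show "inj_on snd {(u, v) \<in> edges t. P v}"
      by (auto simp: inj_on_def edges_def)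
    show "snd ` {(u, v) \<in> edges t. P v} = {v \<in> vertices t. v \<noteq> [] \<and> P v}"
    proof (intro equalityI subsetI)
      fix v
      assume "v \<in> {v \<in> vertices t. v \<noteq> [] \<and> P v}"
      then have "(butlast v, v) \<in> {(u, v) \<in> edges t. P v}"
        using vertex_prefix [of t "butlast v" "last v"]
        by (auto simp: edges_def vertices_def intro!: exI [of _ "last v"])
      then show "v \<in> snd ` {(u, v) \<in> edges t. P v}" by force
    qed (auto simp: edges_def)
  qed
  then show ?thesis by (rule bij_betw_same_card)
qed

lemma card_edges_Node: "card (edges (Node ts)) = forest_edges ts"
proof -
  have "{v \<in> vertices (Node ts). v \<noteq> [] \<and> True} = forest_vertices ts"
    by (auto simp: forest_vertices_def)
  then show ?thesis
    using card_edges_such_that [of "Node ts" "\<lambda>_. True"] by (simp add: card_forest_vertices)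
qed

lemma forest_edges_append: "forest_edges (ts @ us) = forest_edges ts + forest_edges us"
  by (induction ts rule: forest_edges.induct) auto

lemma card_edges_tree_of_aux: "card (edges (tree_of_aux ps d)) = code_edges (ps, d)"
proof (induction ps d rule: tree_of_aux.induct)
  case (1 d)
  then show ?case by (simp add: card_edges_Node code_edges_def code_flaws_def)
next
  case (2 l r ps d)
  \<comment> \<open>Displaying the stem subtree as a \<open>Node\<close> lets
    \<open>forest_edges\<close> unfold at it; the induction hypothesis then counts the edges of
    \<open>ts\<close>.\<close>
  obtain ts where ts: "tree_of_aux ps d = Node ts" by (metis plane_tree.exhaust)
  then show ?case using 2
    by (simp add: card_edges_Node forest_edges_append code_edges_def code_flaws_def)
qed

section \<open>Stem size and prefix edges\<close>

text \<open>The lower endpoints of stem edges are the nonempty prefixes of \<open>w\<close>, all of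
  which are vertices.\<close>

lemma card_stem:
  assumes "w \<in> vertices t"
  shows "card (stem t w) = length w"
proof -
  have vertex_prefix: "is_vertex t u" if "is_vertex t (u @ v)" for t u v
    using that by (induction t u rule: is_vertex.induct) auto
  have "card (stem t w) = card {v \<in> vertices t. v \<noteq> [] \<and> prefix v w}"
    unfolding stem_def by (rule card_edges_such_that)
  also have "{v \<in> vertices t. v \<noteq> [] \<and> prefix v w} = set (prefixes w) - {[]}"
    using assms vertex_prefix by (auto simp: vertices_def prefix_def)
  also have "card \<dots> = length w"
    by (simp add: distinct_card)
  finally show ?thesis .
qed

text \<open>Lower endpoints of the prefix edges, described by addresses instead of labels so that
  they can be counted by recursion along the stem.\<close>

definition prefix_vertices :: "plane_tree \<Rightarrow> nat list \<Rightarrow> nat list set" where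
  "prefix_vertices t w = {v \<in> vertices t. v \<noteq> [] \<and> (prefix v w \<or> right_of v w)}"

lemma card_prefix_edges:
  assumes "w \<in> vertices t"
  shows "card (prefix_edges t w) = card (prefix_vertices t w)"
proof -
  have "prefix_edges t w = {(u, v) \<in> edges t. prefix v w \<or> right_of v w}"
    using prefix_edges_iff [OF assms] by (auto simp: stem_def)
  then show ?thesis
    by (simp add: card_edges_such_that prefix_vertices_def)
qed

text \<open>Trees in \<open>l\<close> contribute nothing and those in \<open>r\<close> contribute
  all their vertices. The subtree \<open>t\<close> contributes its own prefix vertices and its root,
  the lower endpoint of the first stem edge.\<close>

lemma card_prefix_vertices_Cons:
  "card (prefix_vertices (Node (l @ t # r)) (length l # w))
     = Suc (card (prefix_vertices t w) + forest_edges r)"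
proof -
  let ?A = "(#) (length l) ` insert [] (prefix_vertices t w)"
    and ?B = "shift (Suc (length l)) ` forest_vertices r"
  have "v \<in> prefix_vertices (Node (l @ t # r)) (length l # w) \<longleftrightarrow> v \<in> ?A \<union> ?B" for v
  proof (cases v)
    case Nil
    then show ?thesis by (auto simp: prefix_vertices_def)
  next
    case (Cons i u)
    consider "i < length l" | "i = length l" | j where "i = Suc (length l) + j"
      by (metis add_Suc less_iff_Suc_add linorder_neqE_nat)
    then show ?thesis
      by cases (use Cons in \<open>auto simp: prefix_vertices_def shift_forest_vertices vertices_def nth_append\<close>)
  qed
  then have "prefix_vertices (Node (l @ t # r)) (length l # w) = ?A \<union> ?B" by blast
  moreover have "?A \<inter> ?B = {}"
    by (auto simp: shift_def)
  moreover have "finite (prefix_vertices t w)" "[] \<notin> prefix_vertices t w"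
    by (auto simp: prefix_vertices_def)
  moreover have "card ?A = card (insert [] (prefix_vertices t w))"
    by (rule card_image) (blast intro: inj_onI)
  ultimately show ?thesis
    by (simp add: card_Un_disjoint card_forest_vertices del: image_insert)
qed

lemma card_prefix_vertices_tree_of_aux:
  "card (prefix_vertices (tree_of_aux ps d) (map (\<lambda>(l, r). length l) ps)) = code_flaws (ps, d)"
proof (induction ps d rule: tree_of_aux.induct)
  case (1 d)
  have "prefix_vertices (Node d) [] = {}" by (auto simp: prefix_vertices_def)
  then show ?case by (simp add: code_flaws_def)
next
  case (2 l r ps d)
  then show ?case by (simp add: card_prefix_vertices_Cons code_flaws_def)
qed

section \<open>The tree bijection and the composite\<close>

lemma tree_of_in_doubly_rooted_trees:
  "tree_of c \<in> doubly_rooted_trees n k m \<longleftrightarrow>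
     code_edges c = n \<and> code_flaws c = m \<and> length (fst c) = k"
  using vertex_tree_of_aux [of "fst c" "snd c"]
  by (auto simp: tree_of_def doubly_rooted_trees_def card_edges_tree_of_aux card_stem
      card_prefix_edges card_prefix_vertices_tree_of_aux)

lemma bij_betw_tree_of:
  "bij_betw tree_of {c. code_edges c = n \<and> code_flaws c = m \<and> length (fst c) = k}
     (doubly_rooted_trees n k m)"
proof (rule bij_betw_imageI)
  show "inj_on tree_of {c. code_edges c = n \<and> code_flaws c = m \<and> length (fst c) = k}"
    using inj_tree_of by (rule inj_on_subset) simp
  \<comment> \<open>Each pair in the set comes from some code; the equivalence proved before then
    shows that this code has the required parameters.\<close>
  have "doubly_rooted_trees n k m \<subseteq> range tree_of"
    using tree_of_surj by (auto simp: doubly_rooted_trees_def vertices_def)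
  then show "tree_of ` {c. code_edges c = n \<and> code_flaws c = m \<and> length (fst c) = k}
      = doubly_rooted_trees n k m"
    using tree_of_in_doubly_rooted_trees by blast
qed

theorem theorem3p3:
  fixes n m k :: nat
  assumes "k \<le> m" and "m \<le> n"
  shows "\<exists>f. bij_betw f (dyck_paths_with_flaws n m k) (doubly_rooted_trees n k m)"
  \<comment> \<open>Decode the path and rebuild the code as a tree: both bijections start from the
    same set of codes.\<close>
  using bij_betw_trans [OF bij_betw_inv_into [OF bij_betw_path_of] bij_betw_tree_of] by blast

end
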